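(* For every $C\in(0,\infty)$, $\alpha\in[0,1)$, $\beta\in[0,1/2)$, and every function $\varepsilon:\mathbb{N}\times(0,1]\to[0,\infty)$ such that for every fixed $\delta\in(0,1]$ one has $\varepsilon(T,\delta)\to0$ as $T\to\infty$, there exist $T\in\mathbb{N}$ and a probability distribution $P$ on $\mathcal{Z}^T$, where $\mathcal{Z}=\mathcal{B}=\{0,1,2\}$ (with discrete $\sigma$-algebras) and $\ell(b,z)=\mathbf{1}_{b\neq z}$ is the classification loss, with the following property: there exist a probability distribution $Q$ on $\mathcal{Z}^T$ and $\delta\in(0,1)$, as well as a $Q$-optimal learner's policy, such that with probability at least $\delta$ under $P$, the average per-round regret $\Delta$ satisfies the lower bounds $$\Delta\geq C\cdot V_T\cdot\frac{1}{\delta^{\alpha}}+\varepsilon(T,\delta)$$ and $$\Delta\geq C\cdot\sqrt{\frac{D(P\|Q)}{T}}\cdot\frac{1}{\delta^{\beta}}+\varepsilon(T,\delta).$$ Here $Q$-optimality, $\Delta$, $V_T$ and $D(P\|Q)$ are as defined in the context.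
   Context: $\mathbb{N}=\{1,2,\dots\}$. For a probability measure $P$ on $\mathcal{Z}^T$ with $\mathcal{Z}$ finite, $K_P^{(t)}(z_1,\dots,z_{t-1},\cdot)$ denotes (a fixed version of) the conditional distribution under $P$ of the $t$-th coordinate given that the first $t-1$ coordinates equal $z_1,\dots,z_{t-1}$; $K_P^{(1)}$ is the marginal distribution of the first coordinate. Similarly for $K_Q^{(t)}$. A policy is a family of functions $b_t:\mathcal{Z}^{t-1}\to\mathcal{B}$, $t=1,\dots,T$ (for $t=1$ the argument is the empty tuple). It is $Q$-optimal if for every $t$ and all $z_1,\dots,z_{t-1}\in\mathcal{Z}$ $$b_t(z_1,\dots,z_{t-1})\in\operatorname*{arg\,min}_{b\in\mathcal{B}}\sum_{z\in\mathcal{Z}}\ell(b,z)\,K_Q^{(t)}(z_1,\dots,z_{t-1},\{z\}).$$ A $P$-optimal policy $(b_t^* )$ is defined the same way with $K_P^{(t)}$ in place of $K_Q^{(t)}$; a choice of such a policy is fixed. Let $(Z_1,\dots,Z_T)\sim P$. The average per-round regret of the learner's policy $(b_t)$ is $$\Delta:=\frac1T\sum_{t=1}^T\big(\ell(b_t(Z_1,\dots,Z_{t-1}),Z_t)-\ell(b_t^*(Z_1,\dots,Z_{t-1}),Z_t)\big).$$ $\|\mu-\nu\|_{\mathrm{TV}}:=\sup_F|\mu(F)-\nu(F)|$ over measurable sets $F$, and $$V_T:=\mathbb{E}_P\Big[\frac1T\sum_{t=1}^T\big\|K_P^{(t)}(Z_1,\dots,Z_{t-1},\cdot)-K_Q^{(t)}(Z_1,\dots,Z_{t-1},\cdot)\big\|_{\mathrm{TV}}\Big].$$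 $D(P\|Q)$ is the Kullback-Leibler divergence (natural logarithm), equal to $\infty$ if $P\not\ll Q$. *)

theory Defs
  imports "HOL-Probability.Probability" "HOL-Library.Numeral_Type"
begin

text \<open>
  A finite alphabet is a type \<open>'z :: finite\<close>; a distribution on its \<open>T\<close>-fold power is a
  \<open>pmf\<close> on lists supported on the lists of length \<open>T\<close>. Rounds are numbered
  \<open>1, \<dots>, T\<close>, so round \<open>t\<close> of an outcome \<open>zs\<close> is \<open>zs ! (t - 1)\<close>, and its history is
  \<open>take (t - 1) zs\<close>. Kernels and policies are only meaningful at pairs \<open>t h\<close>
  with \<open>length h = t - 1\<close>. The alphabet \<open>{0, 1, 2}\<close> is the numeral type \<open>3\<close>, of which
  only the three distinct elements matter, not the arithmetic.
\<close>

type_synonym 'z kernels = "nat \<Rightarrow> 'z list \<Rightarrow> 'z pmf"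
type_synonym ('z, 'b) policy = "nat \<Rightarrow> 'z list \<Rightarrow> 'b"

definition dist_on_power :: "nat \<Rightarrow> 'z list pmf \<Rightarrow> bool" where
  "dist_on_power T P \<longleftrightarrow> set_pmf P \<subseteq> {zs. length zs = T}"

text \<open>
  Being a version of the conditional distributions: prescribed at histories of positive
  probability, an arbitrary distribution at the others. For \<open>t = 1\<close> the conditioning event
  is everything, which gives the first marginal.
\<close>

definition is_cond_kernels :: "nat \<Rightarrow> 'z list pmf \<Rightarrow> 'z kernels \<Rightarrow> bool" where
  "is_cond_kernels T P K \<longleftrightarrow>
    (\<forall>t\<in>{1..T}. \<forall>h. length h = t - 1 \<longrightarrow>
      measure_pmf.prob P {zs. take (t - 1) zs = h} > 0 \<longrightarrow>
      K t h = map_pmf (\<lambda>zs. zs ! (t - 1)) (cond_pmf P {zs. take (t - 1) zs = h}))"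

definition optimal_policy ::
  "nat \<Rightarrow> ('b \<Rightarrow> 'z::finite \<Rightarrow> real) \<Rightarrow> 'z kernels \<Rightarrow> ('z, 'b) policy \<Rightarrow> bool" where
  "optimal_policy T l K b \<longleftrightarrow>
    (\<forall>t\<in>{1..T}. \<forall>h. length h = t - 1 \<longrightarrow>
      is_arg_min (\<lambda>c. \<Sum>z\<in>UNIV. l c z * pmf (K t h) z) (\<lambda>_. True) (b t h))"

definition avg_regret ::
  "nat \<Rightarrow> ('b \<Rightarrow> 'z \<Rightarrow> real) \<Rightarrow> ('z, 'b) policy \<Rightarrow> ('z, 'b) policy \<Rightarrow> 'z list \<Rightarrow> real" where
  "avg_regret T l b b' zs =
    1 / real T * (\<Sum>t=1..T. l (b t (take (t - 1) zs)) (zs ! (t - 1))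
                           - l (b' t (take (t - 1) zs)) (zs ! (t - 1)))"

definition tv_dist :: "'z pmf \<Rightarrow> 'z pmf \<Rightarrow> real" where
  "tv_dist \<mu> \<nu> = (SUP F. \<bar>measure_pmf.prob \<mu> F - measure_pmf.prob \<nu> F\<bar>)"

definition avg_tv :: "nat \<Rightarrow> 'z list pmf \<Rightarrow> 'z kernels \<Rightarrow> 'z kernels \<Rightarrow> real" where
  "avg_tv T P KP KQ =
    measure_pmf.expectation P
      (\<lambda>zs. 1 / real T * (\<Sum>t=1..T. tv_dist (KP t (take (t - 1) zs)) (KQ t (take (t - 1) zs))))"

text \<open>
  In the library, \<open>KL_divergence b M N\<close> is the divergence of \<open>N\<close> from \<open>M\<close>, and
  \<open>absolutely_continuous M N\<close> says \<open>N \<lless> M\<close>, hence the swapped arguments. The library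
  divergence is a Bochner integral, which is adequate here as it is only applied to \<open>P\<close> with
  finite support.
\<close>

definition kl_div :: "'a pmf \<Rightarrow> 'a pmf \<Rightarrow> ereal" where
  "kl_div P Q =
    (if absolutely_continuous (measure_pmf Q) (measure_pmf P)
     then ereal (KL_divergence (exp 1) (measure_pmf Q) (measure_pmf P)) else \<infinity>)"

text \<open>Only used at nonnegative arguments.\<close>

definition ereal_sqrt :: "ereal \<Rightarrow> ereal" where
  "ereal_sqrt x = (if x = \<infinity> then \<infinity> else ereal (sqrt (real_of_ereal x)))"

definition classification_loss :: "'a \<Rightarrow> 'a \<Rightarrow> real" where
  "classification_loss b z = (if b \<noteq> z then 1 else 0)"

end

theory Submission
  imports Defs "HOL-Real_Asymp.Real_Asymp"
begin

text \<open>
  With probability \<open>\<delta>\<close> the source emits \<open>0, 0, 0, \<dots>\<close>, otherwise \<open>1, 1, 1, \<dots>\<close>. The model \<open>Q\<close>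
  agrees with \<open>P\<close> on the first symbol and after an initial \<open>1\<close>, but after an initial \<open>0\<close> it
  predicts independent fair bits in \<open>{0, 1}\<close>; predicting \<open>1\<close> along the history \<open>0, \<dots>, 0\<close> is then
  \<open>Q\<close>-optimal because of the tie. On the event of probability \<open>\<delta>\<close> the regret is at least
  \<open>1 - 2 / T\<close>, whereas \<open>V\<^sub>T \<le> \<delta>\<close> and \<open>D(P\<parallel>Q) / T \<le> \<delta>\<close>. Since \<open>\<delta>\<^bsup>1 - \<alpha>\<^esup>\<close> and \<open>\<delta>\<^bsup>1/2 - \<beta>\<^esup>\<close> tend
  to \<open>0\<close> with \<open>\<delta>\<close>, it suffices to fix a small \<open>\<delta>\<close> and then a large \<open>T\<close>.
\<close>

section \<open>Modes, total variation, conditional kernels and discrete divergence\<close>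

text \<open>Predicting \<open>c\<close> has expected loss \<open>1 - pmf p c\<close>, so the optimal
  predictions are exactly the modes of \<open>p\<close>.\<close>

lemma is_arg_min_classification_loss_iff:
  fixes p :: "'z::finite pmf"
  shows "is_arg_min (\<lambda>c. \<Sum>z\<in>UNIV. classification_loss c z * pmf p z) (\<lambda>_. True) b
    \<longleftrightarrow> (\<forall>c. pmf p c \<le> pmf p b)"
proof -
  have "(\<Sum>z\<in>UNIV. classification_loss c z * pmf p z) = 1 - pmf p c" for c
  proof -
    have "(\<Sum>z\<in>UNIV. classification_loss c z * pmf p z) = (\<Sum>z\<in>UNIV - {c}. pmf p z)"
      by (rule sum.mono_neutral_cong_right) (auto simp: classification_loss_def)
    also have "\<dots> = (\<Sum>z\<in>UNIV. pmf p z) - pmf p c"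
      by (simp add: sum_diff1)
    also have "(\<Sum>z\<in>UNIV. pmf p z) = 1"
      by (rule sum_pmf_eq_1) auto
    finally show ?thesis .
  qed
  then show ?thesis
    by (auto simp: is_arg_min_def not_less)
qed

lemma tv_dist_refl [simp]: "tv_dist \<mu> \<mu> = 0"
  by (simp add: tv_dist_def)

lemma tv_dist_le_1: "tv_dist \<mu> \<nu> \<le> 1"
  unfolding tv_dist_def
proof (rule cSUP_least)
  show "\<bar>measure_pmf.prob \<mu> F - measure_pmf.prob \<nu> F\<bar> \<le> 1" for F
    using measure_pmf.prob_le_1[of \<mu> F] measure_pmf.prob_le_1[of \<nu> F]
    by (smt (verit) measure_nonneg)
qed simp

lemma set_pmf_Int_nonempty_if_prob_pos:
  assumes "measure_pmf.prob P A > 0"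
  shows "set_pmf P \<inter> A \<noteq> {}"
  using assms measure_pmf_zero_iff[of P A] by auto

lemma prob_pos_if_mem_set_pmf:
  assumes "x \<in> set_pmf P" "x \<in> A"
  shows "measure_pmf.prob P A > 0"
  using assms measure_pmf_zero_iff[of P A] by (metis disjoint_iff zero_less_measure_iff)

lemma pmf_cond_kernel:
  assumes "is_cond_kernels T P K" "t \<in> {1..T}" "length h = t - 1"
    and pos: "measure_pmf.prob P {zs. take (t - 1) zs = h} > 0"
  shows "pmf (K t h) c = measure_pmf.prob P {zs. take (t - 1) zs = h \<and> zs ! (t - 1) = c}
    / measure_pmf.prob P {zs. take (t - 1) zs = h}"
proof -
  let ?A = "{zs. take (t - 1) zs = h}"
  have "K t h = map_pmf (\<lambda>zs. zs ! (t - 1)) (cond_pmf P ?A)"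
    using assms unfolding is_cond_kernels_def by blast
  then have "pmf (K t h) c = measure_pmf.prob (cond_pmf P ?A) ((\<lambda>zs. zs ! (t - 1)) -` {c})"
    by (simp add: pmf_map)
  also have "\<dots> = measure_pmf.prob P (?A \<inter> (\<lambda>zs. zs ! (t - 1)) -` {c}) / measure_pmf.prob P ?A"
    using pos by (subst cond_pmf.rep_eq[OF set_pmf_Int_nonempty_if_prob_pos[OF pos]])
      (simp add: measure_uniform_measure measure_pmf.emeasure_eq_measure)
  also have "?A \<inter> (\<lambda>zs. zs ! (t - 1)) -` {c} = {zs. take (t - 1) zs = h \<and> zs ! (t - 1) = c}"
    by auto
  finally show ?thesis .
qed

text \<open>Since \<open>zs\<close> lies in the support, its history has positive probability and
  the kernel there is prescribed. The support of that kernel is then contained in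
  \<open>{c}\<close>.\<close>

lemma cond_kernel_eq_return:
  assumes K: "is_cond_kernels T P K" and t: "t \<in> {1..T}"
    and zs: "zs \<in> set_pmf P" "length zs = T"
    and det: "\<And>ys. ys \<in> set_pmf P \<Longrightarrow> take (t - 1) ys = take (t - 1) zs \<Longrightarrow> ys ! (t - 1) = c"
  shows "K t (take (t - 1) zs) = return_pmf c"
proof -
  let ?A = "{ys. take (t - 1) ys = take (t - 1) zs}"
  have pos: "measure_pmf.prob P ?A > 0"
    by (rule prob_pos_if_mem_set_pmf[OF zs(1)]) simp
  have "K t (take (t - 1) zs) = map_pmf (\<lambda>zs. zs ! (t - 1)) (cond_pmf P ?A)"
    using K t zs pos unfolding is_cond_kernels_def by auto
  moreover have "set_pmf (map_pmf (\<lambda>zs. zs ! (t - 1)) (cond_pmf P ?A)) \<subseteq> {c}"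
    unfolding set_map_pmf set_cond_pmf[OF set_pmf_Int_nonempty_if_prob_pos[OF pos]]
    using det by blast
  ultimately show ?thesis
    using set_pmf_subset_singleton by metis
qed

text \<open>Both distributions have densities with respect to counting measure, which is
  sigma-finite on a countable type; the inclusion of supports is absolute continuity in this
  setting.\<close>

lemma KL_divergence_pmf:
  fixes P Q :: "'a::countable pmf"
  assumes "1 < b" "set_pmf P \<subseteq> set_pmf Q"
  shows "KL_divergence b (measure_pmf Q) (measure_pmf P)
    = measure_pmf.expectation P (\<lambda>x. log b (pmf P x / pmf Q x))"
proof -
  interpret sigma_finite_measure "count_space (UNIV :: 'a set)"
    by (rule sigma_finite_measure_count_space)
  have "KL_divergence b (measure_pmf Q) (measure_pmf P)
    = (\<integral>x. pmf P x * log b (pmf P x / pmf Q x) \<partial>count_space UNIV)"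
    unfolding measure_pmf_eq_density using assms
    by (intro KL_density_density) (auto simp: set_pmf_eq)
  also have "\<dots> = measure_pmf.expectation P (\<lambda>x. log b (pmf P x / pmf Q x))"
    unfolding measure_pmf_eq_density[of P] by (subst integral_density) auto
  finally show ?thesis .
qed

section \<open>Two-component mixtures\<close>

definition mix_pmf :: "real \<Rightarrow> 'a pmf \<Rightarrow> 'a pmf \<Rightarrow> 'a pmf" where
  "mix_pmf d U V = bind_pmf (bernoulli_pmf d) (\<lambda>s. if s then U else V)"

lemma set_pmf_mix:
  assumes "0 < d" "d < 1"
  shows "set_pmf (mix_pmf d U V) = set_pmf U \<union> set_pmf V"
  using assms by (auto simp: mix_pmf_def set_pmf_bernoulli split: if_splits)

lemma pmf_mix:
  assumes "0 < d" "d < 1"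
  shows "pmf (mix_pmf d U V) x = d * pmf U x + (1 - d) * pmf V x"
  using assms by (simp add: mix_pmf_def pmf_bind algebra_simps)

lemma map_mix_pmf: "map_pmf f (mix_pmf d U V) = mix_pmf d (map_pmf f U) (map_pmf f V)"
  by (auto simp: mix_pmf_def map_bind_pmf intro!: bind_pmf_cong)

lemma prob_mix:
  assumes "0 < d" "d < 1"
  shows "measure_pmf.prob (mix_pmf d U V) A
    = d * measure_pmf.prob U A + (1 - d) * measure_pmf.prob V A"
proof -
  \<comment> \<open>Mapping to the truth value of membership in \<open>A\<close> turns event
    probabilities into point masses, where \<open>pmf_mix\<close> applies.\<close>
  have [simp]: "measure_pmf.prob W A = pmf (map_pmf (\<lambda>x. x \<in> A) W) True" for W :: "'a pmf"
    by (simp add: pmf_map vimage_def)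
  show ?thesis
    using assms by (simp add: map_mix_pmf pmf_mix)
qed

lemma expectation_mix_return:
  fixes f :: "'a \<Rightarrow> real"
  assumes "0 < d" "d < 1"
  shows "measure_pmf.expectation (mix_pmf d (return_pmf x) (return_pmf y)) f
    = d * f x + (1 - d) * f y"
proof -
  have "mix_pmf d (return_pmf x) (return_pmf y)
    = map_pmf (\<lambda>s. if s then x else y) (bernoulli_pmf d)"
    by (auto simp: mix_pmf_def map_pmf_def intro!: bind_pmf_cong)
  then show ?thesis
    using assms by simp
qed

section \<open>The constant source and the fair-coin model\<close>

definition two_valued_lists :: "'z \<Rightarrow> 'z \<Rightarrow> nat \<Rightarrow> 'z list set" where
  "two_valued_lists x y n = {xs. set xs \<subseteq> {x, y} \<and> length xs = n}"

lemma finite_two_valued_lists [simp]: "finite (two_valued_lists x y n)"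
  unfolding two_valued_lists_def by (rule finite_lists_length_eq) simp

lemma replicate_mem_two_valued_lists [simp]: "replicate n x \<in> two_valued_lists x y n"
  by (auto simp: two_valued_lists_def)

lemma two_valued_lists_nonempty [simp]: "two_valued_lists x y n \<noteq> {}"
  by (metis empty_iff replicate_mem_two_valued_lists)

lemma card_two_valued_lists: "x \<noteq> y \<Longrightarrow> card (two_valued_lists x y n) = 2 ^ n"
  unfolding two_valued_lists_def by (subst card_lists_length_eq) (auto simp: card_insert_if numeral_2_eq_2)

text \<open>Here \<open>n\<close> counts the rounds after the first, so words have length
  \<open>Suc n\<close>.\<close>

definition const_source :: "real \<Rightarrow> 'z \<Rightarrow> 'z \<Rightarrow> nat \<Rightarrow> 'z list pmf" where
  "const_source d x y n =
    mix_pmf d (return_pmf (replicate (Suc n) x)) (return_pmf (replicate (Suc n) y))"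

text \<open>For \<open>x \<noteq> y\<close> the uniform tail amounts to \<open>n\<close> independent
  fair choices between \<open>x\<close> and \<open>y\<close>.\<close>

definition coin_model :: "real \<Rightarrow> 'z \<Rightarrow> 'z \<Rightarrow> nat \<Rightarrow> 'z list pmf" where
  "coin_model d x y n =
    mix_pmf d (map_pmf ((#) x) (pmf_of_set (two_valued_lists x y n)))
      (return_pmf (replicate (Suc n) y))"

lemma set_pmf_const_source:
  assumes "0 < d" "d < 1"
  shows "set_pmf (const_source d x y n) = {replicate (Suc n) x, replicate (Suc n) y}"
  using assms by (simp add: const_source_def set_pmf_mix insert_commute)

lemma set_pmf_coin_model:
  assumes "0 < d" "d < 1"
  shows "set_pmf (coin_model d x y n)
    = insert (replicate (Suc n) y) ((#) x ` two_valued_lists x y n)"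
  using assms by (simp add: coin_model_def set_pmf_mix)

text \<open>The constant \<open>x\<close> word is one of \<open>2 ^ n\<close> equally likely words
  of the first component; the constant \<open>y\<close> word does not begin with \<open>x\<close>,
  so only the second component produces it.\<close>

lemma pmf_coin_model_replicate:
  assumes "0 < d" "d < 1" "x \<noteq> y"
  shows "pmf (coin_model d x y n) (replicate (Suc n) x) = d / 2 ^ n"
    and "pmf (coin_model d x y n) (replicate (Suc n) y) = 1 - d"
proof -
  have "pmf (map_pmf ((#) x) (pmf_of_set (two_valued_lists x y n))) (replicate (Suc n) x)
      = 1 / 2 ^ n"
    using assms by (simp add: pmf_map_inj' card_two_valued_lists)
  moreover have "pmf (map_pmf ((#) x) (pmf_of_set (two_valued_lists x y n))) (replicate (Suc n) y) = 0"
    using assms by (auto simp: pmf_eq_0_set_pmf)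
  ultimately show "pmf (coin_model d x y n) (replicate (Suc n) x) = d / 2 ^ n"
    and "pmf (coin_model d x y n) (replicate (Suc n) y) = 1 - d"
    using assms by (simp_all add: coin_model_def pmf_mix)
qed

section \<open>Divergence of the source from the model\<close>

text \<open>The density ratio is \<open>2 ^ n\<close> at the constant \<open>x\<close> word, which
  has mass \<open>d\<close>, and \<open>1\<close> at the constant \<open>y\<close> word.\<close>

lemma kl_div_const_source_coin_model:
  fixes x y :: "'z::countable"
  assumes d: "0 < d" "d < 1" and "x \<noteq> y"
  shows "kl_div (const_source d x y n) (coin_model d x y n) = ereal (d * (real n * ln 2))"
proof -
  let ?P = "const_source d x y n" and ?Q = "coin_model d x y n"
  have sub: "set_pmf ?P \<subseteq> set_pmf ?Q"
    using d by (auto simp: set_pmf_const_source set_pmf_coin_model)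
  have ac: "absolutely_continuous (measure_pmf ?Q) (measure_pmf ?P)"
    using sub measure_pmf_zero_iff[of ?P] measure_pmf_zero_iff[of ?Q]
    by (auto simp: absolutely_continuous_def null_sets_def measure_pmf.emeasure_eq_measure)
  have "KL_divergence (exp 1) (measure_pmf ?Q) (measure_pmf ?P)
      = measure_pmf.expectation ?P (\<lambda>z. ln (pmf ?P z / pmf ?Q z))"
    using KL_divergence_pmf[OF _ sub, of "exp 1"] by (simp add: log_def)
  also have "\<dots> = d * (real n * ln 2)"
  proof -
    have "pmf ?P (replicate (Suc n) x) = d" "pmf ?P (replicate (Suc n) y) = 1 - d"
      using assms by (simp_all add: const_source_def pmf_mix)
    then show ?thesis
      unfolding const_source_def expectation_mix_return[OF d]
      \<comment> \<open>The previous unfolding also opened \<open>?P\<close> inside the logarithm;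
        folding it back lets the two point masses above rewrite.\<close>
      unfolding const_source_def[symmetric]
      using assms by (simp add: pmf_coin_model_replicate ln_realpow del: replicate_Suc)
  qed
  finally show ?thesis
    using ac by (simp add: kl_div_def)
qed

section \<open>A model-optimal policy that breaks ties badly\<close>

text \<open>After an initial \<open>x\<close> all tails are equally likely, so comparing two
  predictions means comparing numbers of tails. Round 1 is excluded: there the model emits
  \<open>x\<close> and \<open>y\<close> with weights \<open>d\<close> and
  \<open>1 - d\<close>.\<close>

lemma coin_model_kernel_le:
  assumes d: "0 < d" "d < 1" and xy: "x \<noteq> y"
    and K: "is_cond_kernels (Suc n) (coin_model d x y n) K" and t: "t \<in> {2..Suc n}"
  shows "pmf (K t (replicate (t - 1) x)) c \<le> pmf (K t (replicate (t - 1) x)) y"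
proof -
  let ?Q = "coin_model d x y n" and ?S = "two_valued_lists x y n"
  \<comment> \<open>Removing the initial \<open>x\<close> shifts positions by one, so round
    \<open>t\<close> sits at index \<open>?i\<close> of the tail.\<close>
  let ?h = "replicate (t - 1) x" and ?i = "t - 2"
  let ?B = "\<lambda>c. {zs. take (t - 1) zs = ?h \<and> zs ! (t - 1) = c}"
  have t1: "t - 1 = Suc ?i" and i: "?i < n"
    using t by auto
  have pos: "measure_pmf.prob ?Q {zs. take (t - 1) zs = ?h} > 0"
  proof (rule prob_pos_if_mem_set_pmf)
    show "replicate (Suc n) x \<in> set_pmf ?Q"
      using d by (simp add: set_pmf_coin_model)
    show "replicate (Suc n) x \<in> {zs. take (t - 1) zs = ?h}"
      using t by (auto simp: min_def simp del: replicate_Suc)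
  qed
  \<comment> \<open>For \<open>t \<ge> 2\<close> the history contains the initial \<open>x\<close>,
    which rules out the constant \<open>y\<close> word.\<close>
  have prob_B: "measure_pmf.prob ?Q (?B c)
      = d * (real (card (?S \<inter> (#) x -` ?B c)) / real (card ?S))" for c
    using d xy unfolding t1 by (simp add: coin_model_def prob_mix measure_pmf_of_set)
  \<comment> \<open>Overwriting the symbol of round \<open>t\<close> by \<open>y\<close> is injective once that symbol is known.\<close>
  have "card (?S \<inter> (#) x -` ?B c) \<le> card (?S \<inter> (#) x -` ?B y)"
  proof (rule card_inj_on_le)
    show "inj_on (\<lambda>xs. xs[?i := y]) (?S \<inter> (#) x -` ?B c)"
    proof (rule inj_on_inverseI)
      show "(xs[?i := y])[?i := c] = xs" if "xs \<in> ?S \<inter> (#) x -` ?B c" for xs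
        using that unfolding t1 by auto
    qed
    show "(\<lambda>xs. xs[?i := y]) ` (?S \<inter> (#) x -` ?B c) \<subseteq> ?S \<inter> (#) x -` ?B y"
      using i unfolding t1
      by (auto simp: two_valued_lists_def dest!: set_update_subset_insert[THEN subsetD])
  qed simp
  then have "measure_pmf.prob ?Q (?B c) \<le> measure_pmf.prob ?Q (?B y)"
    unfolding prob_B using d by (intro mult_left_mono divide_right_mono) auto
  moreover have "pmf (K t ?h) c = measure_pmf.prob ?Q (?B c)
      / measure_pmf.prob ?Q {zs. take (t - 1) zs = ?h}" for c
    by (rule pmf_cond_kernel[OF K _ _ pos]) (use t in auto)
  ultimately show ?thesis
    by (simp add: divide_right_mono)
qed

lemma coin_model_optimal_policy:
  fixes K :: "'z::finite kernels"
  assumes "0 < d" "d < 1" "x \<noteq> y" "is_cond_kernels (Suc n) (coin_model d x y n) K"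
  obtains b where "optimal_policy (Suc n) classification_loss K b"
    and "\<And>t. t \<in> {2..Suc n} \<Longrightarrow> b t (replicate (t - 1) x) = y"
proof
  \<comment> \<open>Optimality is required at every history, including null ones where the kernel is
    arbitrary. Away from the tied histories any mode will do, and one exists because the alphabet is
    finite.\<close>
  let ?b = "\<lambda>t h. if t \<in> {2..Suc n} \<and> h = replicate (t - 1) x then y
    else SOME c. \<forall>c'. pmf (K t h) c' \<le> pmf (K t h) c"
  have "\<exists>c. \<forall>c'. pmf p c' \<le> pmf p c" for p :: "'z pmf"
  proof -
    have "Max (range (pmf p)) \<in> range (pmf p)"
      by (rule Max_in) auto
    then obtain c where c: "Max (range (pmf p)) = pmf p c"
      by (rule imageE)
    have "pmf p c' \<le> Max (range (pmf p))" for c'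
      by (rule Max_ge) auto
    then show ?thesis
      unfolding c by blast
  qed
  then have some: "\<forall>c'. pmf p c' \<le> pmf p (SOME c. \<forall>c'. pmf p c' \<le> pmf p c)" for p :: "'z pmf"
    by (rule someI_ex)
  have "\<forall>c'. pmf (K t h) c' \<le> pmf (K t h) (?b t h)" for t h
  proof (cases "t \<in> {2..Suc n} \<and> h = replicate (t - 1) x")
    case True
    then show ?thesis
      using coin_model_kernel_le[OF assms, of t] by simp
  next
    case False
    then show ?thesis
      using some[of "K t h"] by (simp only: if_False) simp
  qed
  then show "optimal_policy (Suc n) classification_loss K ?b"
    unfolding optimal_policy_def is_arg_min_classification_loss_iff by blast
qed simp

section \<open>Total variation and regret\<close>

text \<open>The kernels agree along the constant \<open>y\<close> word, so only the constant
  \<open>x\<close> word, of mass \<open>d\<close>, contributes, and its average distance is at most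
  1.\<close>

lemma avg_tv_const_source_coin_model:
  assumes d: "0 < d" "d < 1" and xy: "x \<noteq> y"
    and KP: "is_cond_kernels (Suc n) (const_source d x y n) KP"
    and KQ: "is_cond_kernels (Suc n) (coin_model d x y n) KQ"
  shows "avg_tv (Suc n) (const_source d x y n) KP KQ \<le> d"
proof -
  let ?P = "const_source d x y n" and ?Q = "coin_model d x y n" and ?T = "Suc n"
  define f where "f zs = 1 / real ?T *
    (\<Sum>t=1..?T. tv_dist (KP t (take (t - 1) zs)) (KQ t (take (t - 1) zs)))" for zs
  \<comment> \<open>With an empty history the conditioning event is everything, and both first
    marginals give \<open>x\<close> mass \<open>d\<close> and \<open>y\<close> mass
    \<open>1 - d\<close>.\<close>
  have initial: "KP 1 [] = KQ 1 []"
  proof -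
    have "KP 1 [] = map_pmf (\<lambda>zs. zs ! 0) (cond_pmf ?P UNIV)"
      and "KQ 1 [] = map_pmf (\<lambda>zs. zs ! 0) (cond_pmf ?Q UNIV)"
      using KP KQ unfolding is_cond_kernels_def by force+
    moreover have "cond_pmf p UNIV = p" for p :: "'a list pmf"
      by (rule pmf_eqI) (simp add: pmf_cond set_pmf_not_empty)
    moreover have "map_pmf (\<lambda>zs. zs ! 0) ?P = map_pmf (\<lambda>zs. zs ! 0) ?Q"
      by (simp add: const_source_def coin_model_def map_mix_pmf pmf.map_comp o_def)
    ultimately show ?thesis
      by simp
  qed
  \<comment> \<open>From round 2 on, the history begins with \<open>y\<close>, and the constant
    \<open>y\<close> word is the only such word in either support.\<close>
  have good: "KP t (take (t - 1) (replicate ?T y)) = KQ t (take (t - 1) (replicate ?T y))"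
    if t: "t \<in> {1..?T}" for t
  proof (cases "t = 1")
    case True
    then show ?thesis using initial by simp
  next
    case False
    then have t1: "t - 1 = Suc (t - 2)" "t - 1 < ?T"
      using t by auto
    have "KP t (take (t - 1) (replicate ?T y)) = return_pmf y"
      by (rule cond_kernel_eq_return[OF KP t])
        (use d xy t1 in \<open>auto simp: set_pmf_const_source nth_Cons'\<close>)
    moreover have "KQ t (take (t - 1) (replicate ?T y)) = return_pmf y"
      by (rule cond_kernel_eq_return[OF KQ t])
        (use d xy t1 in \<open>auto simp: set_pmf_coin_model nth_Cons'\<close>)
    ultimately show ?thesis by simp
  qed
  have "f (replicate ?T y) = 0"
    unfolding f_def using good by (simp del: replicate_Suc)
  moreover have "f (replicate ?T x) \<le> 1"
  proof -
    have "(\<Sum>t=1..?T. tv_dist (KP t (take (t - 1) (replicate ?T x))) (KQ t (take (t - 1) (replicate ?T x))))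
        \<le> (\<Sum>t=1..?T. 1)"
      by (intro sum_mono tv_dist_le_1)
    then show ?thesis
      unfolding f_def by (simp add: field_simps del: replicate_Suc)
  qed
  moreover have "avg_tv ?T ?P KP KQ = d * f (replicate ?T x) + (1 - d) * f (replicate ?T y)"
    unfolding avg_tv_def const_source_def expectation_mix_return[OF d] f_def ..
  ultimately show ?thesis
    using d by (simp add: mult_left_le del: replicate_Suc)
qed

text \<open>From round 2 on, the source kernel along the constant \<open>x\<close> word is a point
  mass, so \<open>b'\<close> predicts correctly while \<open>b\<close> errs every time.\<close>

lemma avg_regret_const_source:
  assumes d: "0 < d" "d < 1" and xy: "x \<noteq> y"
    and K: "is_cond_kernels (Suc n) (const_source d x y n) K"
    and b': "optimal_policy (Suc n) classification_loss K b'"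
    and b: "\<And>t. t \<in> {2..Suc n} \<Longrightarrow> b t (replicate (t - 1) x) = y"
  shows "avg_regret (Suc n) classification_loss b b' (replicate (Suc n) x) \<ge> 1 - 2 / real (Suc n)"
proof -
  let ?T = "Suc n" and ?zs = "replicate (Suc n) x"
  let ?r = "\<lambda>t. classification_loss (b t (take (t - 1) ?zs)) (?zs ! (t - 1))
    - classification_loss (b' t (take (t - 1) ?zs)) (?zs ! (t - 1))"
  have "?r t = 1" if t: "t \<in> {2..?T}" for t
  proof -
    have t': "take (t - 1) ?zs = replicate (t - 1) x" "?zs ! (t - 1) = x" "t - 1 = Suc (t - 2)"
      using t by (auto simp: min_def simp del: replicate_Suc)
    have "K t (take (t - 1) ?zs) = return_pmf x"
      by (rule cond_kernel_eq_return[OF K])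
        (use d xy t t'(3) in \<open>auto simp: set_pmf_const_source nth_Cons'\<close>)
    moreover have "\<forall>c. pmf (K t (take (t - 1) ?zs)) c
        \<le> pmf (K t (take (t - 1) ?zs)) (b' t (take (t - 1) ?zs))"
      using b' t unfolding optimal_policy_def is_arg_min_classification_loss_iff by auto
    \<comment> \<open>A point mass has its atom as unique mode.\<close>
    ultimately have "b' t (take (t - 1) ?zs) = x"
      by (metis pmf_return indicator_simps(1) indicator_simps(2) not_one_le_zero singletonD singletonI)
    then show ?thesis
      using b[OF t] t' xy by (simp add: classification_loss_def del: replicate_Suc)
  qed
  then have "(\<Sum>t=2..?T. ?r t) = real n"
    by simp
  moreover have "(\<Sum>t=1..?T. ?r t) = ?r 1 + (\<Sum>t=2..?T. ?r t)"
    by (subst sum.atLeast_Suc_atMost) (simp_all add: numeral_2_eq_2 del: replicate_Suc)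
  \<comment> \<open>Neither policy is controlled in round 1. The worst case there leaves
    \<open>(n - 1) / (n + 1) = 1 - 2 / (n + 1)\<close>.\<close>
  moreover have "?r 1 \<ge> -1"
    by (simp add: classification_loss_def)
  ultimately have "(\<Sum>t=1..?T. ?r t) \<ge> real n - 1"
    by linarith
  then have "1 / real ?T * (\<Sum>t=1..?T. ?r t) \<ge> 1 / real ?T * (real n - 1)"
    by (intro mult_left_mono) auto
  then show ?thesis
    unfolding avg_regret_def by (simp add: field_simps del: replicate_Suc)
qed

section \<open>Choice of the parameters and conclusion\<close>

lemma eventually_mult_powr_le:
  fixes C \<gamma> e :: real
  assumes "0 < \<gamma>" "0 < e"
  shows "\<forall>\<^sub>F d in at_right 0. C * d powr \<gamma> \<le> e"
proof -
  have "((\<lambda>d. d powr \<gamma>) \<longlongrightarrow> 0) (at_right (0::real))"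
    using assms by real_asymp
  then have "((\<lambda>d. C * d powr \<gamma>) \<longlongrightarrow> C * 0) (at_right 0)"
    by (rule tendsto_mult_left)
  then have "\<forall>\<^sub>F d in at_right 0. C * d powr \<gamma> < e"
    using assms by (intro order_tendstoD(2)) auto
  then show ?thesis
    by eventually_elim simp
qed

theorem theorem5:
  fixes C \<alpha> \<beta> :: real
    and \<epsilon> :: "nat \<Rightarrow> real \<Rightarrow> real"
    and K :: "3 list pmf \<Rightarrow> 3 kernels"
    and bstar :: "3 list pmf \<Rightarrow> (3, 3) policy"
  assumes "0 < C" and "0 \<le> \<alpha>" "\<alpha> < 1" and "0 \<le> \<beta>" "\<beta> < 1 / 2"
    and "\<And>T \<delta>. 1 \<le> T \<Longrightarrow> 0 < \<delta> \<Longrightarrow> \<delta> \<le> 1 \<Longrightarrow> 0 \<le> \<epsilon> T \<delta>"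
    and "\<And>\<delta>. 0 < \<delta> \<Longrightarrow> \<delta> \<le> 1 \<Longrightarrow> (\<lambda>T. \<epsilon> T \<delta>) \<longlonglongrightarrow> 0"
    \<comment> \<open>the fixed versions of the conditional distributions and the fixed choice of optimal policies\<close>
    and "\<And>T P. 1 \<le> T \<Longrightarrow> dist_on_power T P \<Longrightarrow> is_cond_kernels T P (K P)"
    and "\<And>T P. 1 \<le> T \<Longrightarrow> dist_on_power T P \<Longrightarrow>
           optimal_policy T classification_loss (K P) (bstar P)"
  shows "\<exists>T P. 1 \<le> T \<and> dist_on_power T P \<and>
    (\<exists>Q \<delta> b. dist_on_power T Q \<and> 0 < \<delta> \<and> \<delta> < 1 \<and>
      optimal_policy T classification_loss (K Q) b \<and>
      measure_pmf.prob P
        {zs. avg_regret T classification_loss b (bstar P) zs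
               \<ge> C * avg_tv T P (K P) (K Q) * (1 / \<delta> powr \<alpha>) + \<epsilon> T \<delta> \<and>
             ereal (avg_regret T classification_loss b (bstar P) zs)
               \<ge> ereal C * ereal_sqrt (kl_div P Q / ereal (real T)) * ereal (1 / \<delta> powr \<beta>)
                 + ereal (\<epsilon> T \<delta>)} \<ge> \<delta>)"
proof -
  have "\<forall>\<^sub>F d in at_right (0::real). 0 < d \<and> d < 1"
    using eventually_at_right_real[of 0 1] by simp
  \<comment> \<open>The budget is in quarters: \<open>2 / T\<close>, \<epsilon> and each main term
    cost at most \<open>1 / 4\<close>, so the regret \<open>3 / 4\<close> exceeds either bound, at
    most \<open>1 / 2\<close>.\<close>
  moreover have "\<forall>\<^sub>F d in at_right 0. C * d powr (1 - \<alpha>) \<le> 1 / 4"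
    and "\<forall>\<^sub>F d in at_right 0. C * d powr (1 / 2 - \<beta>) \<le> 1 / 4"
    using assms(3,5) by (intro eventually_mult_powr_le; simp)+
  ultimately have "\<forall>\<^sub>F d in at_right 0. (0 < d \<and> d < 1) \<and>
      C * d powr (1 - \<alpha>) \<le> 1 / 4 \<and> C * d powr (1 / 2 - \<beta>) \<le> 1 / 4"
    by eventually_elim simp
  then obtain d where d: "0 < d" "d < 1"
    and d\<alpha>: "C * d powr (1 - \<alpha>) \<le> 1 / 4" and d\<beta>: "C * d powr (1 / 2 - \<beta>) \<le> 1 / 4"
    using eventually_happens'[OF trivial_limit_at_right_real] by blast
  \<comment> \<open>The convergence of \<epsilon> is only pointwise in \<delta>, so \<open>d\<close>
    has to be fixed before \<open>T\<close>.\<close>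
  have "\<forall>\<^sub>F T in sequentially. \<epsilon> T d < 1 / 4"
    using assms(7)[of d] d by (intro order_tendstoD(2)) auto
  then obtain N where N: "\<And>T. N \<le> T \<Longrightarrow> \<epsilon> T d < 1 / 4"
    unfolding eventually_sequentially by blast
  \<comment> \<open>This makes \<open>T = N + 8\<close>, which is at least \<open>N\<close> for the
    bound on \<epsilon> and at least 8 for \<open>2 / T \<le> 1 / 4\<close>.\<close>
  define n where "n = N + 7"
  define T where "T = Suc n"
  have T: "1 \<le> T" "real T \<ge> 8" and \<epsilon>: "\<epsilon> T d < 1 / 4"
    using N[of T] by (auto simp: T_def n_def)
  define P Q where "P = const_source d (0::3) 1 n" and "Q = coin_model d (0::3) 1 n"
  have P: "dist_on_power T P" and Q: "dist_on_power T Q"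
    using d by (auto simp: dist_on_power_def P_def Q_def set_pmf_const_source set_pmf_coin_model
        T_def two_valued_lists_def)
  have neq: "(0::3) \<noteq> 1"
    by simp
  have KP: "is_cond_kernels (Suc n) (const_source d 0 1 n) (K P)"
    and KQ: "is_cond_kernels (Suc n) (coin_model d 0 1 n) (K Q)"
    using assms(8)[OF T(1) P] assms(8)[OF T(1) Q] by (simp_all add: P_def Q_def T_def)
  obtain b where b: "optimal_policy T classification_loss (K Q) b"
    and b1: "\<And>t. t \<in> {2..Suc n} \<Longrightarrow> b t (replicate (t - 1) 0) = 1"
    using coin_model_optimal_policy[OF d neq KQ] unfolding T_def by metis
  let ?zs = "replicate T (0::3)"
  let ?R = "avg_regret T classification_loss b (bstar P) ?zs"
  have "?R \<ge> 1 - 2 / real T"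
    using avg_regret_const_source[where b = b, OF d neq KP assms(9)[OF T(1) P, unfolded T_def] b1]
    unfolding T_def by blast
  moreover have "2 / real T \<le> 1 / 4"
    using T(2) by (simp add: field_simps)
  ultimately have R: "?R \<ge> 3 / 4"
    by linarith
  have TV: "C * avg_tv T P (K P) (K Q) * (1 / d powr \<alpha>) \<le> 1 / 4"
  proof -
    have "C * avg_tv T P (K P) (K Q) * (1 / d powr \<alpha>) \<le> C * d * (1 / d powr \<alpha>)"
      using avg_tv_const_source_coin_model[OF d neq KP KQ] assms(1)
      by (intro mult_right_mono mult_left_mono) (auto simp: P_def Q_def T_def)
    also have "\<dots> = C * d powr (1 - \<alpha>)"
      using d by (simp add: powr_diff)
    finally show ?thesis
      using d\<alpha> by linarith
  qed
  have KL: "ereal C * ereal_sqrt (kl_div P Q / ereal (real T)) * ereal (1 / d powr \<beta>)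
      \<le> ereal (1 / 4)"
  proof -
    \<comment> \<open>As \<open>n < T\<close> and \<open>ln 2 < 1\<close>, the divergence per round
      is at most \<open>d\<close>, which leaves the power \<open>1 / 2 - \<beta>\<close> of
      \<open>d\<close>.\<close>
    have "real n * ln 2 \<le> real T * 1"
      using ln_2_less_1 by (intro mult_mono) (auto simp: T_def)
    then have "d * (real n * ln 2) / real T \<le> d"
      using d T by (simp add: field_simps)
    then have "C * sqrt (d * (real n * ln 2) / real T) * (1 / d powr \<beta>)
        \<le> C * sqrt d * (1 / d powr \<beta>)"
      using assms(1) by (intro mult_right_mono mult_left_mono) auto
    also have "\<dots> = C * d powr (1 / 2 - \<beta>)"
      using d by (simp add: powr_diff powr_half_sqrt)
    finally have "C * sqrt (d * (real n * ln 2) / real T) * (1 / d powr \<beta>) \<le> 1 / 4"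
      using d\<beta> by linarith
    then show ?thesis
      using T kl_div_const_source_coin_model[OF d neq, of n]
      by (simp add: P_def Q_def ereal_sqrt_def)
  qed
  let ?E = "{zs. avg_regret T classification_loss b (bstar P) zs
               \<ge> C * avg_tv T P (K P) (K Q) * (1 / d powr \<alpha>) + \<epsilon> T d \<and>
             ereal (avg_regret T classification_loss b (bstar P) zs)
               \<ge> ereal C * ereal_sqrt (kl_div P Q / ereal (real T)) * ereal (1 / d powr \<beta>)
                 + ereal (\<epsilon> T d)}"
  have "ereal C * ereal_sqrt (kl_div P Q / ereal (real T)) * ereal (1 / d powr \<beta>) + ereal (\<epsilon> T d)
      \<le> ereal (1 / 4) + ereal (\<epsilon> T d)"
    using KL by (rule add_right_mono)
  also have "\<dots> \<le> ereal ?R"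
    using R \<epsilon> by simp
  finally have "?zs \<in> ?E"
    using add_mono[OF TV less_imp_le[OF \<epsilon>]] R by simp
  \<comment> \<open>This single word already has mass exactly \<open>d\<close> under
    \<open>P\<close>.\<close>
  then have "{?zs} \<subseteq> ?E"
    by blast
  then have "measure_pmf.prob P {?zs} \<le> measure_pmf.prob P ?E"
    by (intro measure_pmf.finite_measure_mono) auto
  moreover have "measure_pmf.prob P {?zs} = d"
    using d by (simp add: P_def T_def const_source_def measure_pmf_single pmf_mix)
  ultimately have "measure_pmf.prob P ?E \<ge> d"
    by simp
  with T(1) P Q d b show ?thesis
    by blast
qed

end
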